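(* Let $X$ be a finite set with at least three elements, let $\mathcal{P}=\{X_i \mid i\in I_m\}$ be a partition of $X$ into exactly $m$ blocks, and let $f\in T(X,\mathcal{P})$. Then $f$ is a unit-regular element of the semigroup $T(X,\mathcal{P})$ if and only if for each $i\in I_m\chi^{(f)}$ there exists $j\in I_m$ such that $|X_i|=|X_j|$ and $X_i\cap Xf=X_jf$.
   Context: Maps are written on the right and composed from left to right: $xf$ is the image of $x$ under $f$, $x(fg)=(xf)g$, and $Af$ is the image of a subset $A$ under $f$. $I_m=\{1,\dots,m\}$. A partition of $X$ is a collection of nonempty pairwise disjoint subsets (blocks) with union $X$; distinct indices correspond to distinct blocks. $\mathcal{T}_X$ is the semigroup of all maps $X\to X$ under composition. $T(X,\mathcal{P})=\{f\in\mathcal{T}_X \mid (\forall X_i\in\mathcal{P})(\exists X_j\in\mathcal{P})\; X_if\subseteq X_j\}$, a subsemigroup of $\mathcal{T}_X$ containing the identity map. For $f\in T(X,\mathcal{P})$, the character of $f$ is the map $\chi^{(f)}\colon I_m\to I_m$ defined by $i\chi^{(f)}=j$ whenever $X_if\subseteq X_j$; $I_m\chi^{(f)}$ is its image. An element $a$ of a semigroup $S$ with identity is unit-regular if there is a unit (invertible element) $u\in S$ with $a=aua$. *)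

theory Defs
  imports "HOL-Algebra.Group" "HOL-Library.Disjoint_Sets"
begin

text \<open>
  Maps \<open>X \<rightarrow> X\<close> are extensional functions, so that equality of monoid elements is equality of
  maps on \<open>X\<close>. Maps are composed from left to right: \<open>f \<otimes> g\<close> applies \<open>f\<close> first.
\<close>

definition full_trans_monoid :: "'a set \<Rightarrow> ('a \<Rightarrow> 'a) monoid"
  where "full_trans_monoid X =
    \<lparr>carrier = X \<rightarrow>\<^sub>E X, mult = (\<lambda>f g. compose X g f), one = (\<lambda>x\<in>X. x)\<rparr>"

definition partition_trans_monoid :: "'a set \<Rightarrow> 'a set set \<Rightarrow> ('a \<Rightarrow> 'a) monoid"
  where "partition_trans_monoid X P = (full_trans_monoid X)
    \<lparr>carrier := {f \<in> carrier (full_trans_monoid X). \<forall>A\<in>P. \<exists>B\<in>P. f ` A \<subseteq> B}\<rparr>"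

definition unit_regular :: "('a, 'b) monoid_scheme \<Rightarrow> 'a \<Rightarrow> bool"
  where "unit_regular S a \<longleftrightarrow>
    a \<in> carrier S \<and> (\<exists>u\<in>Units S. a = a \<otimes>\<^bsub>S\<^esub> u \<otimes>\<^bsub>S\<^esub> a)"

text \<open>
  The description below is unique when \<open>B\<close> enumerates a partition without repetition and \<open>f\<close>
  maps blocks into blocks, because blocks are nonempty and pairwise disjoint; see
  \<open>character_eq_iff\<close>.
\<close>

definition character :: "nat \<Rightarrow> (nat \<Rightarrow> 'a set) \<Rightarrow> ('a \<Rightarrow> 'a) \<Rightarrow> nat \<Rightarrow> nat"
  where "character m B f = (\<lambda>i\<in>{1..m}. THE j. j \<in> {1..m} \<and> f ` B i \<subseteq> B j)"

lemma monoid_full_trans_monoid: "monoid (full_trans_monoid X)"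
  by (rule monoidI)
    (auto simp: full_trans_monoid_def compose_def fun_eq_iff restrict_def PiE_def extensional_def
      Pi_def)

lemma monoid_partition_trans_monoid:
  assumes "partition_on X P"
  shows "monoid (partition_trans_monoid X P)"
proof -
  have sub: "x \<in> X" if "x \<in> A" "A \<in> P" for x A
    using that partition_onD1[OF assms] by blast
  show ?thesis
  proof (rule monoidI, goal_cases)
    case (1 f g)
    have "\<exists>C\<in>P. compose X g f ` A \<subseteq> C" if A: "A \<in> P" for A
    proof -
      obtain B where B: "B \<in> P" "f ` A \<subseteq> B"
        using 1(1) A by (auto simp: partition_trans_monoid_def)
      obtain C where C: "C \<in> P" "g ` B \<subseteq> C"
        using 1(2) B(1) by (auto simp: partition_trans_monoid_def)
      have "compose X g f ` A \<subseteq> C"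
        using sub[OF _ A] B(2) C(2) by (auto simp: compose_def)
      with C(1) show ?thesis by blast
    qed
    with 1 show ?case
      by (auto simp: partition_trans_monoid_def full_trans_monoid_def compose_def)
  next
    case 2
    have "(\<lambda>x\<in>X. x) ` A \<subseteq> A" if "A \<in> P" for A
      using sub[OF _ that] by auto
    then show ?case
      by (auto simp: partition_trans_monoid_def full_trans_monoid_def)
  qed (auto simp: partition_trans_monoid_def full_trans_monoid_def compose_def fun_eq_iff
      restrict_def PiE_def extensional_def Pi_def)
qed

lemma character_eq_iff:
  assumes P: "partition_on X (B ` {1..m})" and inj: "inj_on B {1..m}"
    and f: "f \<in> carrier (partition_trans_monoid X (B ` {1..m}))"
    and i: "i \<in> {1..m}" and j: "j \<in> {1..m}"
  shows "character m B f i = j \<longleftrightarrow> f ` B i \<subseteq> B j"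
proof -
  let ?Q = "\<lambda>j. j \<in> {1..m} \<and> f ` B i \<subseteq> B j"
  have uniq: "k = l" if "?Q k" "?Q l" for k l
  proof -
    have "B i \<noteq> {}" using partition_onD3[OF P] i by force
    then have "B k \<inter> B l \<noteq> {}" using that by blast
    then have "B k = B l"
      using disjointD[OF partition_onD2[OF P], of "B k" "B l"] that by blast
    then show ?thesis using inj that by (blast dest: inj_onD)
  qed
  have "\<forall>A\<in>B ` {1..m}. \<exists>C\<in>B ` {1..m}. f ` A \<subseteq> C"
    using f unfolding partition_trans_monoid_def by simp
  then have "\<exists>C\<in>B ` {1..m}. f ` B i \<subseteq> C" using i by (rule bspec[OF _ imageI])
  then have "\<exists>k. ?Q k" by auto
  then obtain k where k: "?Q k" ..
  have "(THE j. ?Q j) = k" by (rule the_equality[of ?Q k, OF k uniq[OF _ k]])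
  then have "character m B f i = k" using i by (simp add: character_def)
  then show ?thesis using k j uniq[of k j] by auto
qed

end

theory Submission
  imports Defs
begin

text \<open>
  Write \<open>T\<close> for the monoid of maps preserving the partition \<open>P\<close>. A unit of \<open>T\<close> is a permutation
  of \<open>X\<close> which permutes the blocks (\<open>Units_partition_trans_monoid_iff\<close>), and \<open>f = f u f\<close> says that
  \<open>u\<close> picks a preimage under \<open>f\<close> of every point of the image of \<open>f\<close>.

  If such a unit \<open>u\<close> exists and \<open>C\<close> is a block meeting the image of \<open>f\<close>, then the block \<open>u ` C\<close> has
  the size of \<open>C\<close> and contains preimages of all image points in \<open>C\<close>; as \<open>f\<close> respects blocks, it maps
  all of \<open>u ` C\<close> into \<open>C\<close>. Hence \<open>D = u ` C\<close> satisfies \<open>f ` D = C \<inter> f ` X\<close>.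

  Conversely, suppose that every block \<open>C\<close> meeting the image has a partner \<open>\<sigma> C\<close> of the same size
  with \<open>f ` \<sigma> C = C \<inter> f ` X\<close>. The partner determines \<open>C\<close>, because \<open>C\<close> is the only block that \<open>f\<close> can
  send it into. So \<open>\<sigma>\<close> is a size-preserving injection between blocks, and finiteness extends it
  to a size-preserving permutation \<open>\<pi>\<close> of all blocks (\<open>extend_inj_to_colour_preserving_perm\<close>). Inside
  a block \<open>C\<close>, a section of \<open>f\<close> over \<open>C \<inter> f ` X\<close> with values in \<open>\<sigma> C\<close> is injective, and equality of
  sizes extends it to a bijection from \<open>C\<close> to \<open>\<pi> C\<close>. These bijections glue to the unit sought.
  The same two principles, extending an injection between sets of equal size and gluing bijections
  between fibres, therefore serve once for blocks and once for points.
\<close>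

section \<open>Extending and gluing bijections\<close>

lemma extend_inj_to_bij:
  assumes fin: "finite A" "finite B" and card: "card A = card B"
    and D: "D \<subseteq> A" and inj: "inj_on g D" and into: "g ` D \<subseteq> B"
  obtains h where "bij_betw h A B" "\<And>x. x \<in> D \<Longrightarrow> h x = g x"
proof -
  have "card (A - D) = card (B - g ` D)"
    using fin card D into inj
    by (simp add: card_Diff_subset card_image finite_subset[OF D] finite_subset[OF into])
  then obtain k where k: "bij_betw k (A - D) (B - g ` D)"
    using fin finite_same_card_bij by blast
  have "bij_betw (\<lambda>x. if x \<in> D then g x else k x) (D \<union> (A - D)) (g ` D \<union> (B - g ` D))"
    using inj k by (intro bij_betw_disjoint_Un) (auto simp: bij_betw_def)
  moreover have "D \<union> (A - D) = A" "g ` D \<union> (B - g ` D) = B" using D into by auto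
  ultimately show thesis using that[of "\<lambda>x. if x \<in> D then g x else k x"] by simp
qed

lemma bij_betw_glue_fibres:
  assumes \<pi>: "bij_betw \<pi> I J" and c: "c ` A \<subseteq> I" and d: "d ` B \<subseteq> J"
    and h: "\<And>i. i \<in> I \<Longrightarrow> bij_betw (h i) {x \<in> A. c x = i} {y \<in> B. d y = \<pi> i}"
  shows "bij_betw (\<lambda>x. h (c x) x) A B"
proof -
  have val: "h (c x) x \<in> B \<and> d (h (c x) x) = \<pi> (c x)" if "x \<in> A" for x
    using bij_betwE[OF h[of "c x"]] that c by auto
  have "inj_on (\<lambda>x. h (c x) x) A"
  proof (rule inj_onI)
    fix x y assume xy: "x \<in> A" "y \<in> A" and eq: "h (c x) x = h (c y) y"
    have I: "c x \<in> I" "c y \<in> I" using c xy by auto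
    have "\<pi> (c x) = \<pi> (c y)" using val[OF xy(1)] val[OF xy(2)] eq by simp
    then have cc: "c x = c y" using bij_betw_imp_inj_on[OF \<pi>] I by (simp add: inj_on_eq_iff)
    show "x = y"
      using bij_betw_imp_inj_on[OF h[OF I(1)]] xy eq cc by (auto dest: inj_onD)
  qed
  moreover have "y \<in> (\<lambda>x. h (c x) x) ` A" if y: "y \<in> B" for y
  proof -
    obtain i where i: "i \<in> I" "\<pi> i = d y" using \<pi> d y by (force simp: bij_betw_def)
    then have "y \<in> h i ` {x \<in> A. c x = i}" using bij_betw_imp_surj_on[OF h[OF i(1)]] y by simp
    then show ?thesis by auto
  qed
  ultimately show ?thesis using val by (auto simp: bij_betw_def)
qed

text \<open>
  Extend the injection on each colour class separately: a class is mapped into itself, so its source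
  and target have the same size.
\<close>

lemma extend_inj_to_colour_preserving_perm:
  assumes fin: "finite I" and D: "D \<subseteq> I" and inj: "inj_on \<sigma> D" and into: "\<sigma> ` D \<subseteq> I"
    and colour: "\<And>i. i \<in> D \<Longrightarrow> c (\<sigma> i) = c i"
  obtains \<pi> where "bij_betw \<pi> I I" "\<And>i. i \<in> I \<Longrightarrow> c (\<pi> i) = c i" "\<And>i. i \<in> D \<Longrightarrow> \<pi> i = \<sigma> i"
proof -
  define cls where "cls k = {i \<in> I. c i = k}" for k
  have "\<exists>h. bij_betw h (cls k) (cls k) \<and> (\<forall>i \<in> D \<inter> cls k. h i = \<sigma> i)" for k
  proof -
    have "inj_on \<sigma> (D \<inter> cls k)" using inj by (rule inj_on_subset) auto
    moreover have "\<sigma> ` (D \<inter> cls k) \<subseteq> cls k" using into colour by (auto simp: cls_def)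
    ultimately obtain h where "bij_betw h (cls k) (cls k)" "\<And>i. i \<in> D \<inter> cls k \<Longrightarrow> h i = \<sigma> i"
      using extend_inj_to_bij[of "cls k" "cls k" "D \<inter> cls k" \<sigma>] fin by (auto simp: cls_def)
    then show ?thesis by blast
  qed
  then obtain h where h: "\<And>k. bij_betw (h k) (cls k) (cls k)"
    and ext: "\<And>k i. i \<in> D \<inter> cls k \<Longrightarrow> h k i = \<sigma> i"
    by metis
  have "bij_betw (\<lambda>i. h (c i) i) I I"
    by (rule bij_betw_glue_fibres[of id "c ` I" "c ` I" c I c I h]) (use h in \<open>auto simp: cls_def\<close>)
  moreover have "c (h (c i) i) = c i" if "i \<in> I" for i
    using bij_betwE[OF h[of "c i"]] that by (auto simp: cls_def)
  moreover have "h (c i) i = \<sigma> i" if "i \<in> D" for i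
    using ext[of i "c i"] D that by (auto simp: cls_def)
  ultimately show thesis using that[of "\<lambda>i. h (c i) i"] by blast
qed

section \<open>Maps preserving a partition and their units\<close>

lemma partition_block_eqI:
  assumes "partition_on X P" "A \<in> P" "C \<in> P" "x \<in> A" "x \<in> C"
  shows "A = C"
  using assms by (auto simp: partition_on_def disjoint_def)

lemma carrier_partition_trans_monoid_iff:
  "f \<in> carrier (partition_trans_monoid X P) \<longleftrightarrow>
    f \<in> X \<rightarrow>\<^sub>E X \<and> (\<forall>A\<in>P. \<exists>C\<in>P. f ` A \<subseteq> C)"
  by (simp add: partition_trans_monoid_def full_trans_monoid_def)

lemma mult_partition_trans_monoid [simp]:
  "f \<otimes>\<^bsub>partition_trans_monoid X P\<^esub> g = compose X g f"
  by (simp add: partition_trans_monoid_def full_trans_monoid_def)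

lemma one_partition_trans_monoid [simp]:
  "\<one>\<^bsub>partition_trans_monoid X P\<^esub> = (\<lambda>x\<in>X. x)"
  by (simp add: partition_trans_monoid_def full_trans_monoid_def)

text \<open>
  A block \<open>A\<close> goes into some block \<open>C\<close> and from there, by the inverse map, into a block which meets
  \<open>A\<close> and hence is \<open>A\<close>; so \<open>C\<close> is covered by the image of \<open>A\<close>.
\<close>

lemma inverse_maps_send_block_onto_block:
  assumes P: "partition_on X P"
    and u: "u \<in> carrier (partition_trans_monoid X P)"
    and v: "v \<in> carrier (partition_trans_monoid X P)"
    and vu: "\<And>x. x \<in> X \<Longrightarrow> v (u x) = x" and uv: "\<And>x. x \<in> X \<Longrightarrow> u (v x) = x"
    and A: "A \<in> P"
  shows "u ` A \<in> P"
proof -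
  have sub: "\<And>C x. C \<in> P \<Longrightarrow> x \<in> C \<Longrightarrow> x \<in> X" using partition_onD1[OF P] by blast
  obtain C where C: "C \<in> P" "u ` A \<subseteq> C"
    using u A by (auto simp: carrier_partition_trans_monoid_iff)
  obtain A' where A': "A' \<in> P" "v ` C \<subseteq> A'"
    using v C by (auto simp: carrier_partition_trans_monoid_iff)
  obtain a where a: "a \<in> A" using A partition_onD3[OF P] by fastforce
  have "v (u a) \<in> A'" using a C(2) A'(2) by blast
  then have "A' = A" using vu sub[OF A a] partition_block_eqI[OF P A'(1) A _ a] by simp
  then have "C \<subseteq> u ` A" using A'(2) uv sub[OF C(1)] by (force simp: image_iff)
  with C show ?thesis by (simp add: subset_antisym)
qed

lemma Units_partition_trans_monoid_iff:
  assumes P: "partition_on X P"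
  shows "u \<in> Units (partition_trans_monoid X P) \<longleftrightarrow>
    u \<in> extensional X \<and> bij_betw u X X \<and> (\<lambda>A. u ` A) ` P = P"
    (is "u \<in> Units ?T \<longleftrightarrow> ?perm")
proof
  assume "u \<in> Units ?T"
  then obtain v where u: "u \<in> carrier ?T" and v: "v \<in> carrier ?T"
    and one: "compose X u v = (\<lambda>x\<in>X. x)" "compose X v u = (\<lambda>x\<in>X. x)"
    by (auto simp: Units_def)
  have uv: "u (v x) = x" and vu: "v (u x) = x" if "x \<in> X" for x
    using fun_cong[OF one(1), of x] fun_cong[OF one(2), of x] that by (auto simp: compose_eq)
  have maps: "u ` X \<subseteq> X" "v ` X \<subseteq> X" "u \<in> extensional X"
    using u v by (auto simp: carrier_partition_trans_monoid_iff PiE_def)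
  have bij: "bij_betw u X X"
    using maps uv vu by (intro bij_betw_byWitness[where f' = v]) auto
  have "A \<in> (\<lambda>A. u ` A) ` P" if A: "A \<in> P" for A
  proof
    show "v ` A \<in> P" using inverse_maps_send_block_onto_block[OF P v u uv vu A] .
    have "A \<subseteq> X" using A partition_onD1[OF P] by blast
    then show "A = u ` v ` A" using uv by (simp add: image_image subset_iff cong: image_cong)
  qed
  moreover have "u ` A \<in> P" if "A \<in> P" for A
    using inverse_maps_send_block_onto_block[OF P u v vu uv that] .
  ultimately show ?perm using maps(3) bij by blast
next
  assume u: ?perm
  define v where "v = restrict (inv_into X u) X"
  have uv: "u (v x) = x" and vu: "v (u x) = x" if "x \<in> X" for x
    using u that bij_betw_inv_into_right[of u X X x] bij_betw_inv_into_left[of u X X x]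
      bij_betwE[of u X X] by (auto simp: v_def)
  have uX: "u \<in> X \<rightarrow>\<^sub>E X" and vX: "v \<in> X \<rightarrow>\<^sub>E X"
    using u bij_betwE[of u X X] bij_betwE[OF bij_betw_inv_into[of u X X]]
    by (auto simp: v_def PiE_def)
  have "\<exists>C\<in>P. u ` A \<subseteq> C" if "A \<in> P" for A using u that by blast
  moreover have "\<exists>C\<in>P. v ` A \<subseteq> C" if "A \<in> P" for A
  proof -
    have "A \<in> (\<lambda>A. u ` A) ` P" using u that by simp
    then obtain C where C: "C \<in> P" "A = u ` C" by blast
    then have "C \<subseteq> X" using partition_onD1[OF P] by blast
    then have "v ` A = C" using vu C(2) by (simp add: image_image subset_iff cong: image_cong)
    with C(1) show ?thesis by blast
  qed
  ultimately have "u \<in> carrier ?T" "v \<in> carrier ?T"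
    using uX vX by (auto simp: carrier_partition_trans_monoid_iff)
  moreover have "compose X u v = (\<lambda>x\<in>X. x)" "compose X v u = (\<lambda>x\<in>X. x)"
    using uv vu by (auto simp: compose_def)
  ultimately show "u \<in> Units ?T" by (auto simp: Units_def)
qed

lemma unit_regular_partition_trans_monoid_iff:
  assumes "f \<in> carrier (partition_trans_monoid X P)"
  shows "unit_regular (partition_trans_monoid X P) f \<longleftrightarrow>
    (\<exists>u \<in> Units (partition_trans_monoid X P). \<forall>x\<in>X. f (u (f x)) = f x)"
proof -
  have f: "f \<in> X \<rightarrow>\<^sub>E X" using assms by (simp add: carrier_partition_trans_monoid_iff)
  have "f = compose X f (compose X u f) \<longleftrightarrow> (\<forall>x\<in>X. f (u (f x)) = f x)" for u
  proof
    assume "f = compose X f (compose X u f)"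
    then have "f x = compose X f (compose X u f) x" for x by simp
    then show "\<forall>x\<in>X. f (u (f x)) = f x" by (metis compose_eq)
  next
    assume "\<forall>x\<in>X. f (u (f x)) = f x"
    then show "f = compose X f (compose X u f)"
      using f by (intro extensionalityI[of f X]) (auto simp: compose_eq PiE_def)
  qed
  then show ?thesis using assms by (simp add: unit_regular_def)
qed

lemma image_block_subset_if_meets:
  assumes P: "partition_on X P" and f: "f \<in> carrier (partition_trans_monoid X P)"
    and A: "A \<in> P" and C: "C \<in> P" and x: "x \<in> A" "f x \<in> C"
  shows "f ` A \<subseteq> C"
proof -
  obtain C' where C': "C' \<in> P" "f ` A \<subseteq> C'"
    using f A by (auto simp: carrier_partition_trans_monoid_iff)
  then have "C' = C" using partition_block_eqI[OF P C'(1) C] x by blast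
  with C' show ?thesis by simp
qed

section \<open>Unit-regularity in terms of blocks\<close>

lemma unit_regular_imp_block_partner:
  assumes P: "partition_on X P" and f: "f \<in> carrier (partition_trans_monoid X P)"
    and reg: "unit_regular (partition_trans_monoid X P) f"
    and C: "C \<in> P" "C \<inter> f ` X \<noteq> {}"
  shows "\<exists>D\<in>P. card C = card D \<and> C \<inter> f ` X = f ` D"
proof -
  obtain u where u: "u \<in> extensional X" "bij_betw u X X" "(\<lambda>A. u ` A) ` P = P"
    and fuf: "\<And>x. x \<in> X \<Longrightarrow> f (u (f x)) = f x"
    using reg f
    by (auto simp: unit_regular_partition_trans_monoid_iff Units_partition_trans_monoid_iff[OF P])
  have CX: "C \<subseteq> X" using C(1) partition_onD1[OF P] by blast
  have D: "u ` C \<in> P" using u(3) C(1) by blast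
  have "card C = card (u ` C)"
    using bij_betw_imp_inj_on[OF u(2)] CX by (simp add: card_image inj_on_subset)
  moreover have "y \<in> f ` u ` C" if "y \<in> C" "y \<in> f ` X" for y
  proof -
    have "f (u y) = y" using that(2) fuf by auto
    then show ?thesis using that(1) by (metis imageI)
  qed
  moreover have "f ` u ` C \<subseteq> C \<inter> f ` X"
  proof -
    obtain x where "x \<in> X" "f x \<in> C" using C(2) by blast
    then have "f ` u ` C \<subseteq> C"
      using fuf by (intro image_block_subset_if_meets[OF P f D C(1), of "u (f x)"]) auto
    then show ?thesis using D partition_onD1[OF P] by blast
  qed
  ultimately show ?thesis using D by blast
qed

text \<open>
  A section of \<open>f\<close> over \<open>C \<inter> f ` X\<close> is injective, so it extends to a bijection when the sizes agree.
\<close>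

lemma bij_extending_section:
  assumes fin: "finite C" "finite D" "card C = card D" and im: "C \<inter> Y \<subseteq> f ` D"
  shows "\<exists>h. bij_betw h C D \<and> (\<forall>y \<in> C \<inter> Y. f (h y) = y)"
proof -
  have "inj_on (inv_into D f) (C \<inter> Y)" using im by (rule inj_on_inv_into)
  moreover have "inv_into D f ` (C \<inter> Y) \<subseteq> D" using im by (auto intro: inv_into_into)
  ultimately obtain h where "bij_betw h C D" "\<And>y. y \<in> C \<inter> Y \<Longrightarrow> h y = inv_into D f y"
    using extend_inj_to_bij[OF fin, of "C \<inter> Y" "inv_into D f"] by auto
  then show ?thesis using im by (metis f_inv_into_f subsetD)
qed

lemma block_partners_imp_unit_regular:
  assumes fin: "finite X" and P: "partition_on X P"
    and f: "f \<in> carrier (partition_trans_monoid X P)"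
    and partner: "\<And>C. C \<in> P \<Longrightarrow> C \<inter> f ` X \<noteq> {} \<Longrightarrow> \<exists>D\<in>P. card C = card D \<and> C \<inter> f ` X = f ` D"
  shows "unit_regular (partition_trans_monoid X P) f"
proof -
  have sub: "C \<subseteq> X" "finite C" if "C \<in> P" for C
    using that partition_onD1[OF P] fin by (auto intro: finite_subset)
  define H where "H = {C \<in> P. C \<inter> f ` X \<noteq> {}}"
  obtain \<sigma> where \<sigma>: "\<And>C. C \<in> H \<Longrightarrow> \<sigma> C \<in> P" "\<And>C. C \<in> H \<Longrightarrow> card (\<sigma> C) = card C"
    "\<And>C. C \<in> H \<Longrightarrow> f ` \<sigma> C = C \<inter> f ` X"
    using partner unfolding H_def mem_Collect_eq by metis
  have inj: "inj_on \<sigma> H"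
  proof (rule inj_onI)
    fix C C' assume CC: "C \<in> H" "C' \<in> H" "\<sigma> C = \<sigma> C'"
    then have "C \<inter> f ` X = C' \<inter> f ` X" using \<sigma>(3) by metis
    moreover obtain y where "y \<in> C \<inter> f ` X" using CC(1) by (auto simp: H_def)
    ultimately have "y \<in> C" "y \<in> C'" by auto
    then show "C = C'" using CC(1,2) partition_block_eqI[OF P, of C C' y] by (simp add: H_def)
  qed
  have HP: "H \<subseteq> P" "\<sigma> ` H \<subseteq> P" using \<sigma>(1) by (auto simp: H_def)
  obtain \<pi> where \<pi>: "bij_betw \<pi> P P" "\<And>C. C \<in> P \<Longrightarrow> card (\<pi> C) = card C"
    "\<And>C. C \<in> H \<Longrightarrow> \<pi> C = \<sigma> C"
    by (rule extend_inj_to_colour_preserving_perm[where c = card,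
          OF finite_elements[OF fin P] HP(1) inj HP(2) \<sigma>(2)]) blast+
  have \<pi>P: "\<pi> C \<in> P" if "C \<in> P" for C using \<pi>(1) that by (rule bij_betw_apply)
  have "\<exists>h. bij_betw h C (\<pi> C) \<and> (\<forall>y \<in> C \<inter> f ` X. f (h y) = y)" if C: "C \<in> P" for C
  proof (rule bij_extending_section)
    \<comment> \<open>A block outside \<open>H\<close> contains no image point, so nothing is asked of \<open>\<pi> C\<close> there.\<close>
    show "C \<inter> f ` X \<subseteq> f ` \<pi> C" using \<sigma>(3) \<pi>(3) C by (cases "C \<in> H") (auto simp: H_def)
  qed (use C \<pi>(2) \<pi>P sub in auto)
  then obtain h where h: "\<And>C. C \<in> P \<Longrightarrow> bij_betw (h C) C (\<pi> C)"
    and sec: "\<And>C y. C \<in> P \<Longrightarrow> y \<in> C \<Longrightarrow> y \<in> f ` X \<Longrightarrow> f (h C y) = y"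
    by (metis IntI)
  define blk where "blk x = (THE C. C \<in> P \<and> x \<in> C)" for x
  have blk_eq: "blk x = C" if "C \<in> P" "x \<in> C" for x C
    unfolding blk_def
    by (rule the_equality) (use that partition_block_eqI[OF P] in \<open>metis+\<close>)
  have blk: "blk x \<in> P" "x \<in> blk x" if x: "x \<in> X" for x
  proof -
    obtain C where "C \<in> P" "x \<in> C" using x partition_onD1[OF P] by blast
    then show "blk x \<in> P" "x \<in> blk x" using blk_eq by auto
  qed
  have fibre: "{x \<in> X. blk x = C} = C" if "C \<in> P" for C
    using blk blk_eq sub that by blast
  define u where "u = restrict (\<lambda>x. h (blk x) x) X"
  have "bij_betw (\<lambda>x. h (blk x) x) X X"
    using \<pi>(1) by (rule bij_betw_glue_fibres[where c = blk and d = blk])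
      (use blk h fibre \<pi>P in auto)
  then have bij: "bij_betw u X X" by (simp add: u_def cong: bij_betw_cong)
  have uC: "u ` C = \<pi> C" if "C \<in> P" for C
  proof -
    have "u ` C = h C ` C"
      using sub(1)[OF that] blk_eq[OF that] by (intro image_cong) (auto simp: u_def)
    then show ?thesis using bij_betw_imp_surj_on[OF h[OF that]] by simp
  qed
  then have "(\<lambda>A. u ` A) ` P = P"
    using bij_betw_imp_surj_on[OF \<pi>(1)] by (simp cong: image_cong)
  then have unit: "u \<in> Units (partition_trans_monoid X P)"
    using bij by (simp add: Units_partition_trans_monoid_iff[OF P] u_def)
  have "f (u (f x)) = f x" if "x \<in> X" for x
  proof -
    have fx: "f x \<in> X" using f that by (auto simp: carrier_partition_trans_monoid_iff)
    then show ?thesis using sec[OF blk[OF fx]] that by (simp add: u_def)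
  qed
  with unit show ?thesis using f by (auto simp: unit_regular_partition_trans_monoid_iff)
qed

section \<open>The criterion in terms of the character\<close>

text \<open>
  This translates the indexed criterion into the one about blocks. If \<open>B i\<close> contains an image point
  \<open>f x\<close>, then \<open>f\<close> sends the whole block of \<open>x\<close> into \<open>B i\<close>; conversely, blocks are nonempty, so a block
  sent into \<open>B i\<close> leaves an image point there.
\<close>

lemma character_image_iff:
  assumes P: "partition_on X (B ` {1..m})" and inj: "inj_on B {1..m}"
    and f: "f \<in> carrier (partition_trans_monoid X (B ` {1..m}))"
  shows "i \<in> character m B f ` {1..m} \<longleftrightarrow> i \<in> {1..m} \<and> B i \<inter> f ` X \<noteq> {}"
proof
  assume "i \<in> character m B f ` {1..m}"
  then obtain k where k: "k \<in> {1..m}" "character m B f k = i" by auto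
  obtain C where "C \<in> B ` {1..m}" "f ` B k \<subseteq> C"
    using f k(1) unfolding carrier_partition_trans_monoid_iff by blast
  then obtain j where j: "j \<in> {1..m}" "f ` B k \<subseteq> B j" by blast
  then have "i = j" using character_eq_iff[OF P inj f k(1) j(1)] k(2) by simp
  moreover have "B k \<noteq> {}" "B k \<subseteq> X" using k(1) partition_onD1[OF P] partition_onD3[OF P] by auto
  ultimately show "i \<in> {1..m} \<and> B i \<inter> f ` X \<noteq> {}" using j by blast
next
  assume i: "i \<in> {1..m} \<and> B i \<inter> f ` X \<noteq> {}"
  then obtain x where x: "x \<in> X" "f x \<in> B i" by blast
  then obtain k where k: "k \<in> {1..m}" "x \<in> B k" using partition_onD1[OF P] by blast
  have "f ` B k \<subseteq> B i" using image_block_subset_if_meets[OF P f _ _ k(2) x(2)] k(1) i by blast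
  then have "character m B f k = i" using character_eq_iff[OF P inj f k(1)] i by blast
  with k(1) show "i \<in> character m B f ` {1..m}" by blast
qed

theorem theorem3p4:
  fixes X :: "'a set" and m :: nat and B :: "nat \<Rightarrow> 'a set" and f :: "'a \<Rightarrow> 'a"
  assumes "finite X" and "card X \<ge> 3"
    and "partition_on X (B ` {1..m})" and "inj_on B {1..m}"
    and "f \<in> carrier (partition_trans_monoid X (B ` {1..m}))"
  shows "unit_regular (partition_trans_monoid X (B ` {1..m})) f \<longleftrightarrow>
    (\<forall>i \<in> character m B f ` {1..m}. \<exists>j\<in>{1..m}. card (B i) = card (B j) \<and> B i \<inter> f ` X = f ` B j)"
    (is "?reg \<longleftrightarrow> ?partners")
proof
  assume ?reg
  show ?partners
  proof
    fix i assume "i \<in> character m B f ` {1..m}"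
    then have "B i \<in> B ` {1..m}" "B i \<inter> f ` X \<noteq> {}"
      using character_image_iff[OF assms(3-5)] by auto
    from unit_regular_imp_block_partner[OF assms(3,5) \<open>?reg\<close> this]
    show "\<exists>j\<in>{1..m}. card (B i) = card (B j) \<and> B i \<inter> f ` X = f ` B j" by blast
  qed
next
  assume partners: ?partners
  show ?reg
  proof (rule block_partners_imp_unit_regular[OF assms(1,3,5)])
    fix C assume C: "C \<in> B ` {1..m}" "C \<inter> f ` X \<noteq> {}"
    then obtain i where i: "i \<in> {1..m}" "C = B i" by blast
    then have "i \<in> character m B f ` {1..m}"
      using C(2) character_image_iff[OF assms(3-5), of i] by simp
    with partners have "\<exists>j\<in>{1..m}. card (B i) = card (B j) \<and> B i \<inter> f ` X = f ` B j"
      by (rule bspec)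
    then show "\<exists>D\<in>B ` {1..m}. card C = card D \<and> C \<inter> f ` X = f ` D" using i(2) by blast
  qed
qed

end
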